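(* The Lie algebra of $\mathrm{Iso}_{\mathrm{sub}}(\mathbb{S}^7_{\mathrm{T},5})\cap O(8)$ coincides with $$\mathfrak{g}_5=\mathrm{span}_{\mathbb{R}}\{A_iA_j : 1\le i<j\le5 \text{ or } (i,j)=(6,7)\}\subset\mathfrak{so}(8).$$
   Context: Let $A_1,\dots,A_7\in\mathfrak{so}(8)$ be a fixed family of real skew-symmetric $8\times 8$ matrices with $A_iA_j+A_jA_i=-2\delta_{ij}I$ for $i,j=1,\dots,7$. $\mathbb{S}^7\subset\mathbb{R}^8$ is the unit sphere. $\mathbb{S}^7_{\mathrm{T},5}=(\mathbb{S}^7,\mathcal{D}_5,g)$ is the subriemannian (SR) manifold with distribution $(\mathcal{D}_5)_q=\mathrm{span}\{A_1q,\dots,A_5q\}\subset T_q\mathbb{S}^7$ and $g$ the restriction to $\mathcal{D}_5$ of the standard Riemannian metric of $\mathbb{S}^7$. An SR isometry of an SR manifold $(M,\mathcal{H},g)$ is a diffeomorphism $\Phi:M\to M$ with $d\Phi_q(\mathcal{H}_q)\subset\mathcal{H}_{\Phi(q)}$ and such that $d\Phi_q:(\mathcal{H}_q,g_q)\to(\mathcal{H}_{\Phi(q)},g_{\Phi(q)})$ is an isometry for every $q\in M$. $\mathrm{Iso}_{\mathrm{sub}}(M)$ denotes the group of all SR isometries. $O(8)$ acts on $\mathbb{S}^7$ by left multiplication, and its elements are identified with the induced diffeomorphisms of $\mathbb{S}^7$; the intersection $\mathrm{Iso}_{\mathrm{sub}}(\mathbb{S}^7_{\mathrm{T},5})\cap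 O(8)$ is a closed (Lie) subgroup of $O(8)$. *)

theory Defs
  imports "HOL-Analysis.Analysis" "HOL-Library.FuncSet"
begin

text \<open>On a finite-dimensional domain, and for open \<open>U\<close>, this is the usual class $C^k$: the
  Frechet derivative exists and all its directional evaluations are of class $C^{k-1}$.\<close>

primrec Ck_on :: "nat \<Rightarrow> 'a::euclidean_space set \<Rightarrow> ('a \<Rightarrow> 'b::real_normed_vector) \<Rightarrow> bool" where
  "Ck_on 0 U f \<longleftrightarrow> continuous_on U f"
| "Ck_on (Suc k) U f \<longleftrightarrow>
     (\<exists>f'. (\<forall>x\<in>U. (f has_derivative f' x) (at x)) \<and> (\<forall>v. Ck_on k U (\<lambda>x. f' x v)))"

definition smooth_on :: "'a::euclidean_space set \<Rightarrow> ('a \<Rightarrow> 'b::real_normed_vector) \<Rightarrow> bool" where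
  "smooth_on U f \<longleftrightarrow> (\<forall>k. Ck_on k U f)"

text \<open>Smoothness of a map on an embedded submanifold \<open>M\<close>, via local smooth extensions to
  the ambient space.\<close>

definition smooth_map_on :: "'a::euclidean_space set \<Rightarrow> ('a \<Rightarrow> 'b::real_normed_vector) \<Rightarrow> bool" where
  "smooth_map_on M f \<longleftrightarrow>
     (\<forall>q\<in>M. \<exists>U F. open U \<and> q \<in> U \<and> smooth_on U F \<and> (\<forall>x\<in>U \<inter> M. F x = f x))"

definition diffeomorphism_on :: "'a::euclidean_space set \<Rightarrow> ('a \<Rightarrow> 'a) \<Rightarrow> bool" where
  "diffeomorphism_on M \<Phi> \<longleftrightarrow>
     bij_betw \<Phi> M M \<and> smooth_map_on M \<Phi> \<and> smooth_map_on M (the_inv_into M \<Phi>)"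

text \<open>The differential of a smooth map \<open>\<Phi>\<close> on an embedded submanifold \<open>M\<close>. Derivatives within
  \<open>M\<close> are not unique as linear maps on the ambient space, but any two of them agree on
  the tangent space of \<open>M\<close> at \<open>q\<close>; so this is meaningful only for tangent vectors \<open>v\<close>.\<close>

definition differential ::
  "'a::euclidean_space set \<Rightarrow> ('a \<Rightarrow> 'b::real_normed_vector) \<Rightarrow> 'a \<Rightarrow> 'a \<Rightarrow> 'b" where
  "differential M \<Phi> q v = frechet_derivative \<Phi> (at q within M) v"

text \<open>Subriemannian isometries of \<open>(M, H, g)\<close>, where \<open>M\<close> is an embedded submanifold, \<open>H q\<close> a
  subspace of the tangent space at \<open>q\<close> and \<open>g q\<close> an inner product on \<open>H q\<close>. Self-maps of \<open>M\<close>
  are represented as extensional functions. When the rank of \<open>H\<close> is constant, an inner product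
  preserving linear map from \<open>H q\<close> into \<open>H (\<Phi> q)\<close> is automatically onto.\<close>

definition Iso_sub ::
  "'a::euclidean_space set \<Rightarrow> ('a \<Rightarrow> 'a set) \<Rightarrow> ('a \<Rightarrow> 'a \<Rightarrow> 'a \<Rightarrow> real) \<Rightarrow> ('a \<Rightarrow> 'a) set" where
  "Iso_sub M H g = {\<Phi> \<in> extensional M. diffeomorphism_on M \<Phi> \<and>
     (\<forall>q\<in>M. differential M \<Phi> q ` H q \<subseteq> H (\<Phi> q) \<and>
        (\<forall>v\<in>H q. \<forall>w\<in>H q.
           g (\<Phi> q) (differential M \<Phi> q v) (differential M \<Phi> q w) = g q v w))}"

definition so_matrices :: "(real^'n^'n) set" where
  "so_matrices = {X. transpose X = - X}"

text \<open>The instance of \<open>power\<close> for \<open>vec\<close> is componentwise, hence an explicit matrix power.\<close>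

primrec matrix_power :: "real^'n^'n \<Rightarrow> nat \<Rightarrow> real^'n^'n" where
  "matrix_power X 0 = mat 1"
| "matrix_power X (Suc n) = X ** matrix_power X n"

definition matrix_exp :: "real^'n^'n \<Rightarrow> real^'n^'n" where
  "matrix_exp X = (\<Sum>n. (1 / fact n) *\<^sub>R matrix_power X n)"

text \<open>The Lie algebra of a closed matrix group \<open>G\<close>, as a subspace of the Lie algebra of all
  matrices with the commutator bracket.\<close>

definition lie_algebra_of :: "(real^'n^'n) set \<Rightarrow> (real^'n^'n) set" where
  "lie_algebra_of G = {X. \<forall>t::real. matrix_exp (t *\<^sub>R X) \<in> G}"

abbreviation S7 :: "(real^8) set" where
  "S7 \<equiv> sphere 0 1"

definition D5 :: "(nat \<Rightarrow> real^8^8) \<Rightarrow> real^8 \<Rightarrow> (real^8) set" where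
  "D5 A q = span {A i *v q | i. i \<in> {1..5}}"

definition Iso_sub_S7_T5 :: "(nat \<Rightarrow> real^8^8) \<Rightarrow> (real^8 \<Rightarrow> real^8) set" where
  "Iso_sub_S7_T5 A = Iso_sub S7 (D5 A) (\<lambda>q v w. v \<bullet> w)"

text \<open>The intersection with \<open>O(8)\<close>, an orthogonal matrix being identified with the self-map of the
  sphere that it induces.\<close>

definition Iso_sub_S7_T5_O8 :: "(nat \<Rightarrow> real^8^8) \<Rightarrow> (real^8^8) set" where
  "Iso_sub_S7_T5_O8 A =
     {Q. orthogonal_matrix Q \<and> restrict (\<lambda>x. Q *v x) S7 \<in> Iso_sub_S7_T5 A}"

definition g5 :: "(nat \<Rightarrow> real^8^8) \<Rightarrow> (real^8^8) set" where
  "g5 A = span {A i ** A j | i j. (1 \<le> i \<and> i < j \<and> j \<le> 5) \<or> (i = 6 \<and> j = 7)}"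

end

theory Submission
  imports Defs
begin

text \<open>An orthogonal \<open>Q\<close> preserves the distribution iff \<open>Q A\<^sub>k q\<close> is orthogonal to \<open>A\<^sub>l Q q\<close> for all unit
  \<open>q\<close>, \<open>k \<le> 5\<close> and \<open>l = 6, 7\<close>, because \<open>q, A\<^sub>1 q, \<dots>, A\<^sub>7 q\<close> is an orthonormal basis of the ambient space.

  For \<open>X\<close> in the span of the given products, \<open>[A\<^sub>6, X] = - c A\<^sub>7\<close> and \<open>[A\<^sub>7, X] = c A\<^sub>6\<close> for some \<open>c\<close>. So the
  two functions \<open>h\<^sub>l(t) = \<langle>exp(tX) A\<^sub>k q, A\<^sub>l exp(tX) q\<rangle>\<close> satisfy \<open>h\<^sub>6' = - c h\<^sub>7\<close>, \<open>h\<^sub>7' = c h\<^sub>6\<close>: the sum of their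
  squares is constant, and it vanishes at \<open>t = 0\<close>.

  Conversely, the 64 products of at most three distinct \<open>A\<^sub>i\<close> form an orthogonal basis of all
  \<open>8 \<times> 8\<close> matrices. A skew \<open>X\<close> has no component at the products of zero or three factors, and
  differentiating the invariance condition at \<open>t = 0\<close> kills its components at the \<open>A\<^sub>m\<close> and at the
  \<open>A\<^sub>k A\<^sub>l\<close> with \<open>k \<le> 5 < l\<close>.\<close>

section \<open>Matrices and the matrix exponential\<close>

lemma matrix_add_rdistrib: "((A::real^'n^'m) + B) ** C = A ** C + B ** C"
  by (vector matrix_matrix_mult_def sum.distrib distrib_right)

lemma matrix_diff_ldistrib: "(A::real^'n^'m) ** (B - C) = A ** B - A ** C"
  by (vector matrix_matrix_mult_def sum_subtractf right_diff_distrib)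

lemma matrix_diff_rdistrib: "((A::real^'n^'m) - B) ** C = A ** C - B ** C"
  by (vector matrix_matrix_mult_def sum_subtractf left_diff_distrib)

lemma matrix_minus_left: "(- (A::real^'n^'m)) ** B = - (A ** B)"
  by (vector matrix_matrix_mult_def sum_negf)

lemma matrix_minus_right: "(A::real^'n^'m) ** (- B) = - (A ** B)"
  by (vector matrix_matrix_mult_def sum_negf)

lemma minus_matrix_vector_mult: "(- (A::real^'n^'m)) *v x = - (A *v x)"
  by (vector matrix_vector_mult_def sum_negf)

lemmas matrix_ring_simps = matrix_diff_ldistrib matrix_diff_rdistrib matrix_minus_left
  matrix_minus_right matrix_add_ldistrib matrix_add_rdistrib scalar_matrix_assoc[symmetric]
  matrix_scalar_ac

lemma transpose_plus: "transpose (A + B :: real^'n^'m) = transpose A + transpose B"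
  by (vector transpose_def)

lemma subspace_so_matrices: "subspace (so_matrices :: (real^'n^'n) set)"
  by (auto simp: subspace_def so_matrices_def transpose_plus transpose_scalar)
     (vector transpose_def)

lemma matrix_inner_adjoint: "(M *v u) \<bullet> v = u \<bullet> (transpose M *v v)" for M :: "real^'n^'m"
  by (metis dot_lmul_matrix inner_commute transpose_matrix_vector)

lemma so_matrices_inner:
  assumes "X \<in> so_matrices"
  shows "(X *v u) \<bullet> v = - (u \<bullet> (X *v v))"
  using matrix_inner_adjoint[of X u v] assms
  by (simp add: so_matrices_def minus_matrix_vector_mult del: transpose_matrix_vector)

text \<open>Polarization: expanding the quadratic form at \<open>x + y\<close> leaves the symmetric
  part of \<open>X\<close> as a bilinear form, which then vanishes.\<close>

lemma so_matrices_iff_quadratic: "X \<in> so_matrices \<longleftrightarrow> (\<forall>q. q \<bullet> (X *v q) = 0)"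
proof
  assume "X \<in> so_matrices"
  then show "\<forall>q. q \<bullet> (X *v q) = 0"
    using so_matrices_inner[of X] by (metis inner_commute neg_equal_zero)
next
  assume q: "\<forall>q. q \<bullet> (X *v q) = 0"
  have "(X *v x) \<bullet> y + x \<bullet> (X *v y) = 0" for x y
    using q[rule_format, of "x + y"] q
    by (simp add: algebra_simps inner_add_left inner_add_right inner_commute)
  then have "x \<bullet> ((transpose X + X) *v y) = 0" for x y
    by (metis matrix_inner_adjoint matrix_vector_mult_add_rdistrib inner_add_right)
  then have "transpose X + X = 0"
    by (metis inner_eq_zero_iff matrix_eq matrix_vector_mult_0)
  then show "X \<in> so_matrices"
    by (simp add: so_matrices_def eq_neg_iff_add_eq_0)
qed

section \<open>The Frobenius inner product and its norm\<close>

lemma matrix_inner_eq_sum: "(M::real^'n^'m) \<bullet> N = (\<Sum>i\<in>UNIV. \<Sum>j\<in>UNIV. M$i$j * N$i$j)"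
  by (simp add: inner_vec_def)

lemma matrix_inner_transpose: "transpose M \<bullet> transpose N = (M::real^'n^'m) \<bullet> N"
  unfolding matrix_inner_eq_sum transpose_def by (simp) (rule sum.swap)

text \<open>With respect to the Frobenius product, the adjoint of a one-sided multiplication is
  multiplication by the transpose on the same side. All coefficient computations below move factors
  this way.\<close>

lemma matrix_inner_mult_right: "(M ** P) \<bullet> N = (M::real^'n^'m) \<bullet> (N ** transpose P)"
  unfolding matrix_inner_eq_sum matrix_matrix_mult_def transpose_def
  by (simp add: sum_distrib_left sum_distrib_right mult_ac)
     (intro sum.cong refl, rule sum.swap)

lemma matrix_inner_mult_left: "(P ** M) \<bullet> N = (M::real^'n^'m) \<bullet> (transpose P ** N)"
  by (metis matrix_inner_mult_right matrix_inner_transpose matrix_transpose_mul)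

lemma skew_inner_symmetric:
  assumes "M \<in> so_matrices" "transpose N = N"
  shows "M \<bullet> N = 0"
  using matrix_inner_transpose[of M N] assms by (simp add: so_matrices_def)

lemma norm_matrix_vector_mult_le: "norm ((M::real^'n^'m) *v x) \<le> norm M * norm x"
proof (rule power2_le_imp_le)
  have "(norm (M *v x))\<^sup>2 = (\<Sum>i\<in>UNIV. (M$i \<bullet> x)\<^sup>2)"
    unfolding norm_vec_def L2_set_def
    by (simp add: sum_nonneg matrix_vector_mul_component)
  also have "\<dots> \<le> (\<Sum>i\<in>UNIV. (norm (M$i))\<^sup>2 * (norm x)\<^sup>2)"
    by (intro sum_mono) (metis Cauchy_Schwarz_ineq2 abs_le_square_iff abs_mult abs_norm_cancel power_mult_distrib)
  also have "\<dots> = (norm M * norm x)\<^sup>2"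
    by (simp add: power_mult_distrib norm_vec_def[of M] L2_set_def sum_nonneg sum_distrib_right)
  finally show "(norm (M *v x))\<^sup>2 \<le> (norm M * norm x)\<^sup>2" .
qed simp

text \<open>The vector estimate is applied to each column of \<open>N\<close>; the norm is built
  from rows, hence the passage to transposes.\<close>

lemma norm_matrix_mult_le: "norm ((M::real^'n^'m) ** (N::real^'k^'n)) \<le> norm M * norm N"
proof (rule power2_le_imp_le)
  have tr: "norm (transpose P) = norm P" for P :: "real^'a^'b"
    by (simp add: norm_eq_sqrt_inner matrix_inner_transpose)
  have "transpose (M ** N) $ j = M *v (transpose N $ j)" for j
    by (simp add: vec_eq_iff transpose_def matrix_matrix_mult_def matrix_vector_mult_def)
  then have "(norm (transpose (M ** N)))\<^sup>2 = (\<Sum>j\<in>UNIV. (norm (M *v (transpose N $ j)))\<^sup>2)"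
    by (simp add: norm_vec_def[of "transpose (M ** N)"] L2_set_def sum_nonneg)
  also have "\<dots> \<le> (\<Sum>j\<in>UNIV. (norm M)\<^sup>2 * (norm (transpose N $ j))\<^sup>2)"
    by (intro sum_mono) (metis norm_matrix_vector_mult_le power_mono norm_ge_zero power_mult_distrib)
  also have "\<dots> = (norm M * norm (transpose N))\<^sup>2"
    by (simp add: power_mult_distrib norm_vec_def[of "transpose N"] L2_set_def sum_nonneg sum_distrib_left)
  finally show "(norm (M ** N))\<^sup>2 \<le> (norm M * norm N)\<^sup>2"
    by (simp add: tr)
qed simp

text \<open>The last factor covers the case \<open>n = 0\<close>: the Frobenius norm of the identity
  is not 1 in general.\<close>

lemma norm_matrix_power_le: "norm (matrix_power X n) \<le> norm X ^ n * norm (mat 1 :: real^'n^'n)"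
  for X :: "real^'n^'n"
proof (induction n)
  case (Suc n)
  have "norm (matrix_power X (Suc n)) \<le> norm X * norm (matrix_power X n)"
    by (simp add: norm_matrix_mult_le)
  also have "\<dots> \<le> norm X * (norm X ^ n * norm (mat 1 :: real^'n^'n))"
    by (intro mult_left_mono Suc) simp
  finally show ?case by (simp add: mult.assoc)
qed simp

lemma summable_matrix_exp: "summable (\<lambda>n. (1 / fact n) *\<^sub>R matrix_power X n)"
  for X :: "real^'n^'n"
proof (rule summable_comparison_test)
  let ?C = "norm (mat 1 :: real^'n^'n)"
  show "summable (\<lambda>n. (norm X ^ n /\<^sub>R fact n) * ?C)"
    by (intro summable_mult2 summable_exp_generic)
  show "\<exists>N. \<forall>n\<ge>N. norm ((1 / fact n) *\<^sub>R matrix_power X n) \<le> (norm X ^ n /\<^sub>R fact n) * ?C"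
    using norm_matrix_power_le[of X]
    by (auto simp: divide_simps)
qed

section \<open>Calculus along the curve exp(tX)\<close>

lemma matrix_power_scaleR: "matrix_power (t *\<^sub>R X) n = t ^ n *\<^sub>R matrix_power X n"
  by (induction n) (simp_all add: matrix_ring_simps mult.commute)

lemma matrix_exp_0: "matrix_exp 0 = mat 1"
proof -
  have "(\<Sum>n. (1 / fact n) *\<^sub>R matrix_power (0::real^'n^'n) n) =
      (\<Sum>n\<in>{0}. (1 / fact n) *\<^sub>R matrix_power 0 n)"
    by (rule suminf_finite) (auto simp: gr0_conv_Suc)
  then show ?thesis
    by (simp add: matrix_exp_def)
qed

text \<open>Each coordinate of exp(tX) is a real power series in t that converges everywhere, so it
  can be differentiated term by term.\<close>

lemma matrix_exp_has_vector_derivative: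
  "((\<lambda>t. matrix_exp (t *\<^sub>R X)) has_vector_derivative X ** matrix_exp (t *\<^sub>R X)) (at t)"
  for X :: "real^'n^'n"
  unfolding has_vector_derivative_def
proof (rule has_derivative_componentwise_within[THEN iffD2], rule ballI)
  fix b :: "real^'n^'n"
  define c where "c n = (1 / fact n) * (matrix_power X n \<bullet> b)" for n
  have bl: "bounded_linear (\<lambda>M. M \<bullet> b)" by (rule bounded_linear_inner_left)
  have pow: "((1 / fact n) *\<^sub>R matrix_power (s *\<^sub>R X) n) \<bullet> b = c n * s ^ n" for s n
    by (simp add: c_def matrix_power_scaleR)
  have sm: "summable (\<lambda>n. c n * s ^ n)" for s
    using bounded_linear.summable[OF bl summable_matrix_exp[of "s *\<^sub>R X"]] by (simp only: pow)
  have ex: "matrix_exp (s *\<^sub>R X) \<bullet> b = (\<Sum>n. c n * s ^ n)" for s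
    unfolding matrix_exp_def bounded_linear.suminf[OF bl summable_matrix_exp] pow ..
  have bl2: "bounded_linear (\<lambda>M. (X ** M) \<bullet> b)"
    by (intro linear_conv_bounded_linear[THEN iffD1] linearI)
       (simp_all add: matrix_ring_simps inner_add_left)
  \<comment> \<open>\<open>diffs c n\<close> is (n+1) times \<open>c (Suc n)\<close>; the factor n+1
    cancels against the factorial and the extra power of \<open>X\<close> comes out on the
    left.\<close>
  have dterm: "(X ** ((1 / fact n) *\<^sub>R matrix_power (t *\<^sub>R X) n)) \<bullet> b = diffs c n * t ^ n" for n
    by (simp add: c_def diffs_def matrix_power_scaleR matrix_ring_simps del: of_nat_Suc)
  have "(X ** matrix_exp (t *\<^sub>R X)) \<bullet> b = (\<Sum>n. diffs c n * t ^ n)"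
    unfolding matrix_exp_def bounded_linear.suminf[OF bl2 summable_matrix_exp] dterm ..
  then have "((\<lambda>t. matrix_exp (t *\<^sub>R X) \<bullet> b) has_field_derivative
      (X ** matrix_exp (t *\<^sub>R X)) \<bullet> b) (at t)"
    unfolding ex using termdiffs_strong_converges_everywhere[OF sm, of t] by simp
  then show "((\<lambda>t. matrix_exp (t *\<^sub>R X) \<bullet> b) has_derivative
      (\<lambda>h. (h *\<^sub>R (X ** matrix_exp (t *\<^sub>R X))) \<bullet> b)) (at t)"
    unfolding has_field_derivative_def
    by (rule has_derivative_eq_rhs) (auto simp: mult.commute)
qed

lemma matrix_exp_vector_derivative:
  "((\<lambda>t. matrix_exp (t *\<^sub>R X) *v v) has_vector_derivative X *v (matrix_exp (t *\<^sub>R X) *v v)) (at t)"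
  for X :: "real^'n^'n"
proof -
  have "bounded_linear (\<lambda>M::real^'n^'n. M *v v)"
    by (intro linear_conv_bounded_linear[THEN iffD1] linearI)
       (simp_all add: matrix_vector_mult_add_rdistrib scaleR_matrix_vector_assoc)
  from bounded_linear.has_vector_derivative[OF this matrix_exp_has_vector_derivative]
  show ?thesis by (simp add: matrix_vector_mul_assoc)
qed

lemma matrix_exp_inner_derivative:
  fixes X B :: "real^'n^'n"
  defines "E \<equiv> \<lambda>t. matrix_exp (t *\<^sub>R X)"
  shows "((\<lambda>t. (E t *v u) \<bullet> (B *v (E t *v v))) has_real_derivative
    (X *v (E t *v u)) \<bullet> (B *v (E t *v v)) + (E t *v u) \<bullet> (B *v (X *v (E t *v v)))) (at t)"
proof -
  have d: "((\<lambda>t. E t *v w) has_derivative (\<lambda>h. h *\<^sub>R (X *v (E t *v w)))) (at t)" for w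
    using matrix_exp_vector_derivative[of X w t] by (simp add: has_vector_derivative_def E_def)
  have "((\<lambda>t. B *v (E t *v v)) has_derivative (\<lambda>h. B *v (h *\<^sub>R (X *v (E t *v v))))) (at t)"
    by (rule bounded_linear.has_derivative[OF matrix_vector_mul_bounded_linear d])
  from has_derivative_inner[OF d[of u] this] show ?thesis
    unfolding has_field_derivative_def
    by (rule has_derivative_eq_rhs) (auto simp: matrix_vector_mult_scaleR algebra_simps)
qed

text \<open>Skewness moves \<open>X\<close> from the first argument to the second with a sign, so
  the two terms of the product rule merge into a commutator.\<close>

lemma matrix_exp_inner_derivative_skew:
  fixes X B :: "real^'n^'n"
  defines "E \<equiv> \<lambda>t. matrix_exp (t *\<^sub>R X)"
  assumes X: "X \<in> so_matrices"
  shows "((\<lambda>t. (E t *v u) \<bullet> (B *v (E t *v v))) has_real_derivative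
    (E t *v u) \<bullet> ((B ** X - X ** B) *v (E t *v v))) (at t)"
proof -
  have "(B ** X - X ** B) *v w = B *v (X *v w) - X *v (B *v w)" for w
    by (simp add: matrix_vector_mult_diff_rdistrib matrix_vector_mul_assoc)
  then show ?thesis
    using matrix_exp_inner_derivative[of X u B v t]
    by (simp add: E_def so_matrices_inner[OF X] flip: inner_diff_right)
qed

lemma orthogonal_matrix_iff_inner:
  "orthogonal_matrix (Q::real^'n^'n) \<longleftrightarrow> (\<forall>u v. (Q *v u) \<bullet> (Q *v v) = u \<bullet> v)"
  using orthogonal_transformation_matrix[of "\<lambda>x. Q *v x"]
  by (simp add: orthogonal_transformation_def)

lemma orthogonal_matrix_exp:
  fixes X :: "real^'n^'n"
  assumes "X \<in> so_matrices"
  shows "orthogonal_matrix (matrix_exp (t *\<^sub>R X))"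
proof -
  have "(matrix_exp (t *\<^sub>R X) *v u) \<bullet> (matrix_exp (t *\<^sub>R X) *v v) = u \<bullet> v" for u v
  proof -
    have "((\<lambda>t. (matrix_exp (t *\<^sub>R X) *v u) \<bullet> (matrix_exp (t *\<^sub>R X) *v v))
        has_real_derivative 0) (at t)" for t
      using matrix_exp_inner_derivative_skew[OF assms, of u "mat 1" v t] by simp
    then have "(matrix_exp (t *\<^sub>R X) *v u) \<bullet> (matrix_exp (t *\<^sub>R X) *v v) =
        (matrix_exp (0 *\<^sub>R X) *v u) \<bullet> (matrix_exp (0 *\<^sub>R X) *v v)"
      by (intro DERIV_isconst_all) blast
    then show ?thesis by (simp add: matrix_exp_0)
  qed
  then show ?thesis by (simp add: orthogonal_matrix_iff_inner)
qed

lemma so_matrices_if_orthogonal_exp: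
  fixes X :: "real^'n^'n"
  assumes "\<And>t. orthogonal_matrix (matrix_exp (t *\<^sub>R X))"
  shows "X \<in> so_matrices"
  unfolding so_matrices_iff_quadratic
proof
  fix q
  let ?f = "\<lambda>t. (matrix_exp (t *\<^sub>R X) *v q) \<bullet> (matrix_exp (t *\<^sub>R X) *v q)"
  have "?f = (\<lambda>t. q \<bullet> q)"
    using assms by (simp add: orthogonal_matrix_iff_inner)
  moreover have "(?f has_real_derivative (X *v q) \<bullet> q + q \<bullet> (X *v q)) (at 0)"
    using matrix_exp_inner_derivative[of X q "mat 1" q 0] by (simp add: matrix_exp_0)
  ultimately have "(X *v q) \<bullet> q + q \<bullet> (X *v q) = 0"
    by (metis DERIV_const DERIV_unique)
  then show "q \<bullet> (X *v q) = 0"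
    by (simp add: inner_commute)
qed

section \<open>Orthogonal families\<close>

lemma spans_if_orthogonal_card:
  fixes b :: "'i \<Rightarrow> 'a::euclidean_space"
  assumes "finite I" "card I = DIM('a)"
    and nz: "\<And>i. i \<in> I \<Longrightarrow> b i \<noteq> 0"
    and orth: "\<And>i j. i \<in> I \<Longrightarrow> j \<in> I \<Longrightarrow> i \<noteq> j \<Longrightarrow> b i \<bullet> b j = 0"
  shows "span (b ` I) = UNIV"
proof -
  have "inj_on b I"
    by (rule inj_onI) (metis inner_eq_zero_iff nz orth)
  then have "card (b ` I) = DIM('a)"
    using assms by (simp add: card_image)
  moreover have "independent (b ` I)"
    using nz orth by (intro pairwise_orthogonal_independent) (auto simp: pairwise_def orthogonal_def)
  ultimately show ?thesis
    by (metis dim_eq_card_independent dim_eq_full)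
qed

text \<open>The part of \<open>x\<close> orthogonal to the span of the \<open>b j\<close> with
  \<open>j\<close> in \<open>J\<close> is orthogonal to the whole spanning family, hence
  zero.\<close>

lemma in_span_if_orthogonal_rest:
  fixes b :: "'i \<Rightarrow> 'a::euclidean_space"
  assumes sp: "span (b ` I) = UNIV"
    and orth: "\<And>i j. i \<in> I \<Longrightarrow> j \<in> I \<Longrightarrow> i \<noteq> j \<Longrightarrow> b i \<bullet> b j = 0"
    and J: "J \<subseteq> I" and x: "\<And>i. i \<in> I - J \<Longrightarrow> x \<bullet> b i = 0"
  shows "x \<in> span (b ` J)"
proof -
  obtain y z where y: "y \<in> span (b ` J)" and z: "\<And>w. w \<in> span (b ` J) \<Longrightarrow> orthogonal z w"
    and xyz: "x = y + z"
    using orthogonal_subspace_decomp_exists[of "b ` J" x] by blast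
  have "orthogonal z (b i)" if "i \<in> I" for i
  proof (cases "i \<in> J")
    case False
    have "b i \<bullet> b j = 0" if "j \<in> J" for j
      using orth[of i j] J that False \<open>i \<in> I\<close> by blast
    then have "orthogonal (b i) y"
      by (intro orthogonal_to_span[OF y]) (auto simp: orthogonal_def)
    then show ?thesis
      using x[of i] that False xyz
      by (simp add: orthogonal_def inner_add_right inner_commute[of _ "b i"])
  qed (use z span_base in blast)
  then have "orthogonal z z"
    by (intro orthogonal_to_span[of z "b ` I"]) (auto simp: sp)
  then show ?thesis
    using y xyz by (simp add: orthogonal_self)
qed

section \<open>Orthogonal matrices as subriemannian isometries of a sphere\<close>

text \<open>A derivative within the sphere is determined on tangent vectors by the great circles
  through \<open>q\<close>.\<close>

lemma has_derivative_within_sphere_unique: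
  fixes f :: "'a::euclidean_space \<Rightarrow> 'b::real_normed_vector"
  assumes f: "(f has_derivative f') (at q within sphere 0 1)"
    and g: "(f has_derivative g') (at q within sphere 0 1)"
    and q: "q \<in> sphere 0 1" and v: "v \<bullet> q = 0"
  shows "f' v = g' v"
proof -
  have lin: "linear f'" "linear g'"
    using f g by (auto intro: has_derivative_linear)
  have unit: "f' u = g' u" if u: "u \<bullet> q = 0" "norm u = 1" for u
  proof -
    \<comment> \<open>The great circle through \<open>q\<close> with velocity \<open>u\<close>:
      along it both candidate derivatives become ordinary derivatives at 0, where uniqueness
      holds.\<close>
    define c where "c s = cos s *\<^sub>R q + sin s *\<^sub>R u" for s :: real
    have nq: "q \<bullet> q = 1" "u \<bullet> u = 1" "q \<bullet> u = 0"
      using q u by (simp_all add: dot_square_norm inner_commute)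
    have "c s \<bullet> c s = (cos s)\<^sup>2 + (sin s)\<^sup>2" for s
      by (simp add: c_def inner_add_left inner_add_right nq u power2_eq_square)
    then have c: "c ` UNIV \<subseteq> sphere 0 1"
      by (auto simp: norm_eq_1 inner_commute)
    have c0: "c 0 = q" by (simp add: c_def)
    have dc: "(c has_derivative (\<lambda>h. h *\<^sub>R u)) (at 0)"
      unfolding c_def by (auto intro!: derivative_eq_intros)
    have "((\<lambda>s. F (c s)) has_derivative (\<lambda>h. F' (h *\<^sub>R u))) (at 0)"
      if "(F has_derivative F') (at q within sphere 0 1)" for F F'
      using has_derivative_in_compose[OF dc, of F F'] has_derivative_subset[OF _ c, of F F' "c 0"]
        that c0 by simp
    from this[OF f] this[OF g] have "(\<lambda>h. f' (h *\<^sub>R u)) = (\<lambda>h. g' (h *\<^sub>R u))"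
      by (rule has_derivative_unique)
    then show ?thesis by (metis scaleR_one)
  qed
  show ?thesis
  proof (cases "v = 0")
    case False
    have "f' (v /\<^sub>R norm v) = g' (v /\<^sub>R norm v)"
      using False v by (intro unit) simp_all
    then show ?thesis
      using False by (simp add: linear_scale[OF lin(1)] linear_scale[OF lin(2)])
  qed (simp add: linear_0 lin)
qed

text \<open>The derivative does not depend on the point, so after one differentiation only constant
  maps remain.\<close>

lemma smooth_on_bounded_linear:
  assumes "bounded_linear f"
  shows "smooth_on U f"
proof -
  have const: "Ck_on k U (\<lambda>x. c)" for k and c :: 'b
  proof (induction k arbitrary: c)
    case (Suc k)
    then show ?case
      by (auto intro!: exI[of _ "\<lambda>x v. 0"])
  qed simp
  have "Ck_on k U f" for k
  proof (cases k)
    case 0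
    then show ?thesis using assms by (simp add: linear_continuous_on)
  next
    case (Suc k')
    then show ?thesis
      using const assms by (auto intro!: exI[of _ "\<lambda>x. f"] bounded_linear_imp_has_derivative)
  qed
  then show ?thesis by (simp add: smooth_on_def)
qed

lemma smooth_map_on_bounded_linear:
  assumes "bounded_linear F" "\<And>x. x \<in> M \<Longrightarrow> f x = F x"
  shows "smooth_map_on M f"
  unfolding smooth_map_on_def
  using assms by (intro ballI exI[of _ UNIV] exI[of _ F]) (auto intro: smooth_on_bounded_linear)

lemma orthogonal_matrix_norm: "orthogonal_matrix Q \<Longrightarrow> norm (Q *v x) = norm x"
  for Q :: "real^'n^'n"
  by (simp add: norm_eq_sqrt_inner orthogonal_matrix_iff_inner)

lemma diffeomorphism_on_sphere_orthogonal:
  fixes Q :: "real^'n^'n"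
  assumes Q: "orthogonal_matrix Q"
  defines "\<Phi> \<equiv> restrict ((*v) Q) (sphere 0 1)"
  shows "diffeomorphism_on (sphere 0 1) \<Phi>"
proof -
  have inv: "transpose Q *v (Q *v x) = x" "Q *v (transpose Q *v x) = x" for x
    using Q by (simp_all add: matrix_vector_mul_assoc orthogonal_matrix_def del: transpose_matrix_vector)
  have T: "orthogonal_matrix (transpose Q)" using Q by simp
  have bij: "bij_betw \<Phi> (sphere 0 1) (sphere 0 1)"
    by (rule bij_betwI[of _ _ _ "(*v) (transpose Q)"])
      (auto simp: \<Phi>_def inv orthogonal_matrix_norm[OF Q] orthogonal_matrix_norm[OF T]
        simp del: transpose_matrix_vector)
  have "the_inv_into (sphere 0 1) \<Phi> x = transpose Q *v x" if "x \<in> sphere 0 1" for x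
    using that bij
    by (intro the_inv_into_f_eq)
      (auto simp: \<Phi>_def inv orthogonal_matrix_norm[OF T] bij_betw_def simp del: transpose_matrix_vector)
  then have "smooth_map_on (sphere 0 1) (the_inv_into (sphere 0 1) \<Phi>)"
    by (rule smooth_map_on_bounded_linear[OF matrix_vector_mul_bounded_linear])
  moreover have "smooth_map_on (sphere 0 1) \<Phi>"
    by (rule smooth_map_on_bounded_linear[OF matrix_vector_mul_bounded_linear]) (simp add: \<Phi>_def)
  ultimately show ?thesis
    using bij by (simp add: diffeomorphism_on_def)
qed

text \<open>\<open>frechet_derivative\<close> picks some derivative within the sphere; tangency of
  \<open>v\<close> is what identifies its value with that of \<open>Q\<close>.\<close>

lemma differential_restrict_matrix:
  fixes Q :: "real^'n^'n"
  assumes q: "q \<in> sphere 0 1" and v: "v \<bullet> q = 0"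
  shows "differential (sphere 0 1) (restrict ((*v) Q) (sphere 0 1)) q v = Q *v v"
proof -
  let ?\<Phi> = "restrict ((*v) Q) (sphere 0 1)"
  have d: "(?\<Phi> has_derivative (*v) Q) (at q within sphere 0 1)"
    by (rule has_derivative_transform[OF q _ bounded_linear_imp_has_derivative[OF matrix_vector_mul_bounded_linear]])
       simp
  then have "?\<Phi> differentiable at q within sphere 0 1"
    by (rule differentiableI)
  then show ?thesis
    unfolding differential_def frechet_derivative_works
    by (rule has_derivative_within_sphere_unique[OF _ d q v])
qed

text \<open>Orthogonality of \<open>Q\<close> already yields the diffeomorphism and the preservation
  of the metric; only the condition on the distribution is left.\<close>

lemma restrict_matrix_in_Iso_sub_iff:
  fixes Q :: "real^'n^'n"
  assumes Q: "orthogonal_matrix Q"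
    and H: "\<And>q v. q \<in> sphere 0 1 \<Longrightarrow> v \<in> H q \<Longrightarrow> v \<bullet> q = 0"
  shows "restrict ((*v) Q) (sphere 0 1) \<in> Iso_sub (sphere 0 1) H (\<lambda>q v w. v \<bullet> w) \<longleftrightarrow>
    (\<forall>q\<in>sphere 0 1. (*v) Q ` H q \<subseteq> H (Q *v q))"
proof -
  have d: "differential (sphere 0 1) (restrict ((*v) Q) (sphere 0 1)) q v = Q *v v"
    if "q \<in> sphere 0 1" "v \<in> H q" for q v
    using that H by (intro differential_restrict_matrix)
  show ?thesis
    unfolding Iso_sub_def
    using diffeomorphism_on_sphere_orthogonal[OF Q] Q
    by (auto simp: d orthogonal_matrix_iff_inner image_subset_iff)
qed

section \<open>The Clifford family\<close>

text \<open>Conjugation by \<open>A j\<close> acts on the product of the \<open>A i\<close>, \<open>i \<in> S\<close>, by the sign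
  \<open>(-1)^card (S - {j})\<close>. The bound 3 guarantees an index outside \<open>S \<union> T\<close>, and that index reveals
  the parity of the cardinality.\<close>

lemma parity_separates_small_subsets:
  fixes S T :: "nat set"
  assumes S: "S \<subseteq> {1..7}" "card S \<le> 3" and T: "T \<subseteq> {1..7}" "card T \<le> 3" and "S \<noteq> T"
  obtains j where "j \<in> {1..7}" "even (card (S - {j})) \<noteq> even (card (T - {j}))"
proof -
  have False if eq: "\<And>j. j \<in> {1..7} \<Longrightarrow> even (card (S - {j})) = even (card (T - {j}))"
  proof -
    have fin: "finite S" "finite T"
      using S T finite_subset by auto
    have "card (S \<union> T) < card {1..7::nat}"
      using card_Un_le[of S T] S T by simp
    then have "\<not> {1..7} \<subseteq> S \<union> T"
      using fin card_mono[of "S \<union> T" "{1..7}"] by auto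
    then obtain j0 where "j0 \<in> {1..7}" "j0 \<notin> S" "j0 \<notin> T" by blast
    then have parity: "even (card S) = even (card T)"
      using eq[of j0] by simp
    have "even (card (U - {j})) = (even (card U) \<noteq> (j \<in> U))" if "finite U" for U and j :: nat
      using that by (cases "j \<in> U") (auto simp: card_Diff_singleton card_gt_0_iff)
    then have "j \<in> S \<longleftrightarrow> j \<in> T" if "j \<in> {1..7}" for j
      using eq[OF that] parity fin by auto
    then show False
      using S T \<open>S \<noteq> T\<close> by blast
  qed
  then show thesis using that by blast
qed

text \<open>Index set of a basis: 1 + 7 + 21 + 35 = 64 is the dimension of the space of 8 by 8
  matrices.\<close>

definition small_subsets :: "nat set set" where
  "small_subsets = {S. S \<subseteq> {1..7} \<and> card S \<le> 3}"

lemma card_small_subsets: "card small_subsets = 64"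
proof -
  have "small_subsets = (\<Union>k\<in>{..3}. {S. S \<subseteq> {1..7} \<and> card S = k})"
    by (auto simp: small_subsets_def)
  also have "card \<dots> = (\<Sum>k\<le>3. card {S. S \<subseteq> {1..7::nat} \<and> card S = k})"
    by (rule card_UN_disjoint) auto
  also have "\<dots> = (\<Sum>k\<le>3. 7 choose k)"
    by (simp add: n_subsets)
  also have "\<dots> = 64"
    by (simp add: numeral_eq_Suc)
  finally show ?thesis .
qed

lemma finite_small_subsets: "finite small_subsets"
  unfolding small_subsets_def by (rule finite_subset[of _ "Pow {1..7}"]) auto

text \<open>The elements are listed in increasing order so that \<open>sorted_list_of_set\<close>
  evaluates to an explicit list in each case.\<close>

lemma small_subsets_cases:
  assumes "S \<in> small_subsets"
  obtains "S = {}" | i where "i \<in> {1..7}" "S = {i}"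
    | i j where "i \<in> {1..7}" "j \<in> {1..7}" "i < j" "S = {i, j}"
    | i j k where "i \<in> {1..7}" "j \<in> {1..7}" "k \<in> {1..7}" "i < j" "j < k" "S = {i, j, k}"
proof -
  have S: "S \<subseteq> {1..7}" "card S \<le> 3" "finite S"
    using assms finite_subset[of S "{1..7}"] by (auto simp: small_subsets_def)
  define xs where "xs = sorted_list_of_set S"
  have xs: "sorted_wrt (<) xs" "set xs = S" "length xs = card S"
    using S by (simp_all add: xs_def)
  show thesis
  proof (cases xs)
    case Nil
    then show thesis using that(1) xs by simp
  next
    case 1: (Cons a ys)
    show thesis
    proof (cases ys)
      case Nil
      then have "S = {a}" using xs(2) 1 by simp
      then show thesis using that(2)[of a] S by simp
    next
      case 2: (Cons b zs)
      show thesis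
      proof (cases zs)
        case Nil
        then have "S = {a, b}" "a < b" using xs 1 2 by auto
        then show thesis using that(3)[of a b] S by simp
      next
        case 3: (Cons c ws)
        then have "ws = []" using xs S 1 2 by (cases ws) auto
        then have "S = {a, b, c}" "a < b" "b < c" using xs 1 2 3 by auto
        then show thesis using that(4)[of a b c] S by simp
      qed
    qed
  qed
qed

section \<open>Algebra of the Clifford family and the invariance condition\<close>

locale clifford7 =
  fixes A :: "nat \<Rightarrow> real^8^8"
  assumes skew: "\<And>i. i \<in> {1..7} \<Longrightarrow> A i \<in> so_matrices"
    and clifford: "\<And>i j. i \<in> {1..7} \<Longrightarrow> j \<in> {1..7} \<Longrightarrow>
      A i ** A j + A j ** A i = (if i = j then -2 else 0) *\<^sub>R mat 1"
begin

lemma square: "i \<in> {1..7} \<Longrightarrow> A i ** A i = - mat 1"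
proof -
  assume "i \<in> {1..7}"
  then have "2 *\<^sub>R (A i ** A i) = 2 *\<^sub>R (- mat 1)"
    using clifford[of i i] by (simp add: scaleR_2)
  then show ?thesis by (metis scaleR_cancel_left zero_neq_numeral)
qed

lemma anticommute:
  assumes "i \<in> {1..7}" "j \<in> {1..7}" "i \<noteq> j"
  shows "A i ** A j = - (A j ** A i)"
  using clifford[of i j] assms by (simp add: eq_neg_iff_add_eq_0)

lemma square_left: "i \<in> {1..7} \<Longrightarrow> A i ** (A i ** M) = - M"
  by (simp add: matrix_mul_assoc square matrix_minus_left)

lemma anticommute_left:
  assumes "i \<in> {1..7}" "j \<in> {1..7}" "i \<noteq> j"
  shows "A i ** (A j ** M) = - (A j ** (A i ** M))"
  using assms anticommute[of i j] by (simp add: matrix_mul_assoc matrix_minus_left)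

lemma transpose_A: "i \<in> {1..7} \<Longrightarrow> transpose (A i) = - A i"
  using skew[of i] by (simp add: so_matrices_def)

lemma inner_mult_left:
  "i \<in> {1..7} \<Longrightarrow> (A i ** M) \<bullet> (A i ** N) = M \<bullet> N"
  by (simp add: matrix_inner_mult_left transpose_A matrix_minus_left square_left)

lemma inner_mult_right:
  "i \<in> {1..7} \<Longrightarrow> (M ** A i) \<bullet> (N ** A i) = M \<bullet> N"
  by (simp add: matrix_inner_mult_right transpose_A matrix_minus_right square
      flip: matrix_mul_assoc)

lemma orthogonal_A: "i \<in> {1..7} \<Longrightarrow> orthogonal_matrix (A i)"
  by (simp add: orthogonal_matrix transpose_A matrix_minus_left square)

lemma product_skew:
  assumes "i \<in> {1..7}" "j \<in> {1..7}" "i \<noteq> j"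
  shows "A i ** A j \<in> so_matrices"
  unfolding so_matrices_def mem_Collect_eq matrix_transpose_mul
  using assms anticommute[of j i]
  by (simp add: transpose_A matrix_minus_left matrix_minus_right)

lemma inner_A_self: "i \<in> {1..7} \<Longrightarrow> (A i *v q) \<bullet> q = 0"
  using skew[of i] by (simp add: so_matrices_iff_quadratic inner_commute)

lemma inner_A_A:
  assumes "i \<in> {1..7}" "j \<in> {1..7}" "i \<noteq> j"
  shows "(A i *v q) \<bullet> (A j *v q) = 0"
  using product_skew[OF assms] skew[OF assms(1)]
  by (simp add: so_matrices_inner matrix_vector_mul_assoc so_matrices_iff_quadratic)

text \<open>Turns membership in a span into equations: \<open>q\<close> and the seven
  \<open>A i *v q\<close> form an orthonormal basis, and the listed vectors are those missing from
  the span.\<close>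

lemma D5_iff:
  assumes q: "q \<in> S7"
  shows "v \<in> D5 A q \<longleftrightarrow> v \<bullet> q = 0 \<and> v \<bullet> (A 6 *v q) = 0 \<and> v \<bullet> (A 7 *v q) = 0"
proof
  assume "v \<in> D5 A q"
  then have v: "v \<in> span {A i *v q |i. i \<in> {1..5}}" by (simp add: D5_def)
  have orth: "orthogonal w v" if "w = q \<or> w = A 6 *v q \<or> w = A 7 *v q" for w
    using that inner_A_self inner_A_A
    by (intro orthogonal_to_span[OF v]) (auto simp: orthogonal_def inner_commute[of w])
  show "v \<bullet> q = 0 \<and> v \<bullet> (A 6 *v q) = 0 \<and> v \<bullet> (A 7 *v q) = 0"
    using orth[of q] orth[of "A 6 *v q"] orth[of "A 7 *v q"]
    by (simp add: orthogonal_def inner_commute[of v])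
next
  assume v: "v \<bullet> q = 0 \<and> v \<bullet> (A 6 *v q) = 0 \<and> v \<bullet> (A 7 *v q) = 0"
  \<comment> \<open>Index 0 is free in the family, so it carries the normal vector
    \<open>q\<close>.\<close>
  define b where "b i = (if i = 0 then q else A i *v q)" for i :: nat
  have nz: "b i \<noteq> 0" if "i \<in> {0..7}" for i
  proof -
    have "norm (b i) = 1"
      using q that by (auto simp: b_def orthogonal_matrix_norm orthogonal_A)
    then show ?thesis by auto
  qed
  have orth: "b i \<bullet> b j = 0" if "i \<in> {0..7}" "j \<in> {0..7}" "i \<noteq> j" for i j
    using that inner_A_self[of i q] inner_A_self[of j q] inner_A_A[of i j q]
    by (auto simp: b_def inner_commute)
  have sp: "span (b ` {0..7}) = UNIV"
    using nz orth by (intro spans_if_orthogonal_card) simp_all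
  have "{0..7} - {1..5} = {0, 6, 7::nat}" by auto
  then have "v \<in> span (b ` {1..5})"
    using v by (intro in_span_if_orthogonal_rest[OF sp orth]) (auto simp: b_def)
  moreover have "b ` {1..5} = {A i *v q |i. i \<in> {1..5}}"
    by (auto simp: b_def image_iff)
  ultimately show "v \<in> D5 A q" by (simp add: D5_def)
qed

text \<open>By linearity it suffices to test the spanning vectors. Of the three equations for the
  distribution, orthogonality to \<open>Q *v q\<close> is automatic, since \<open>Q\<close> is
  orthogonal and \<open>A k\<close> is skew.\<close>

lemma in_Iso_sub_S7_T5_O8_iff:
  "Q \<in> Iso_sub_S7_T5_O8 A \<longleftrightarrow> orthogonal_matrix Q \<and>
    (\<forall>q\<in>S7. \<forall>k\<in>{1..5}. \<forall>l\<in>{6, 7}. (Q *v (A k *v q)) \<bullet> (A l *v (Q *v q)) = 0)"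
proof (cases "orthogonal_matrix Q")
  case Q: True
  have "(*v) Q ` D5 A q \<subseteq> D5 A (Q *v q) \<longleftrightarrow>
      (\<forall>k\<in>{1..5}. \<forall>l\<in>{6, 7}. (Q *v (A k *v q)) \<bullet> (A l *v (Q *v q)) = 0)"
    if q: "q \<in> S7" for q
  proof -
    have Qq: "Q *v q \<in> S7" using q Q by (simp add: orthogonal_matrix_norm)
    let ?B = "(*v) Q ` {A i *v q |i. i \<in> {1..5}}"
    have "(*v) Q ` D5 A q = span ?B"
      unfolding D5_def by (rule linear_span_image[symmetric]) simp
    moreover have "span ?B \<subseteq> D5 A (Q *v q) \<longleftrightarrow> ?B \<subseteq> D5 A (Q *v q)"
      using span_minimal[of ?B "D5 A (Q *v q)"] span_superset[of ?B]
      by (auto simp only: D5_def subspace_span)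
    moreover have "?B \<subseteq> D5 A (Q *v q) \<longleftrightarrow> (\<forall>k\<in>{1..5}. Q *v (A k *v q) \<in> D5 A (Q *v q))"
      by blast
    ultimately have "(*v) Q ` D5 A q \<subseteq> D5 A (Q *v q) \<longleftrightarrow> (\<forall>k\<in>{1..5}. Q *v (A k *v q) \<in> D5 A (Q *v q))"
      by simp
    also have "\<dots> \<longleftrightarrow> (\<forall>k\<in>{1..5}. \<forall>l\<in>{6, 7}. (Q *v (A k *v q)) \<bullet> (A l *v (Q *v q)) = 0)"
      using Q by (auto simp: D5_iff[OF Qq] orthogonal_matrix_iff_inner inner_A_self)
    finally show ?thesis .
  qed
  moreover have "v \<bullet> q = 0" if "q \<in> S7" "v \<in> D5 A q" for q v
    using that D5_iff by blast
  ultimately show ?thesis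
    using restrict_matrix_in_Iso_sub_iff[OF Q, of "D5 A"] Q
    by (simp add: Iso_sub_S7_T5_O8_def Iso_sub_S7_T5_def)
qed (simp add: Iso_sub_S7_T5_O8_def)

section \<open>The inclusion of \<open>g5 A\<close> in the Lie algebra\<close>

lemma g5_subset_so: "g5 A \<subseteq> so_matrices"
  unfolding g5_def using product_skew
  by (intro span_minimal subspace_so_matrices) auto

lemma g5_commutators:
  assumes "X \<in> g5 A"
  shows "\<exists>c. A 6 ** X - X ** A 6 = (- c) *\<^sub>R A 7 \<and> A 7 ** X - X ** A 7 = c *\<^sub>R A 6"
  using assms unfolding g5_def
proof (induction rule: span_induct_alt)
  case base
  show ?case by (intro exI[of _ 0]) simp
next
  case (step a X Y)
  then obtain c where c: "A 6 ** Y - Y ** A 6 = (- c) *\<^sub>R A 7" "A 7 ** Y - Y ** A 7 = c *\<^sub>R A 6"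
    by blast
  have "\<exists>d. A 6 ** X - X ** A 6 = (- d) *\<^sub>R A 7 \<and> A 7 ** X - X ** A 7 = d *\<^sub>R A 6"
  proof -
    from step(1) obtain i j where X: "X = A i ** A j"
      and "(1 \<le> i \<and> i < j \<and> j \<le> 5) \<or> (i = 6 \<and> j = 7)" by blast
    then consider "1 \<le> i" "i < j" "j \<le> 5" | "i = 6" "j = 7" by blast
    then show ?thesis
    proof cases
      case 1
      \<comment> \<open>\<open>A l\<close> anticommutes with both factors of \<open>X\<close>, and
        the two signs cancel.\<close>
      then have "A l ** X - X ** A l = 0" if "l \<in> {6, 7}" for l
        using that 1 anticommute_left[of l i "A j"] anticommute[of l j]
        by (auto simp: X matrix_minus_right simp flip: matrix_mul_assoc)
      then show ?thesis by (intro exI[of _ 0]) simp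
    next
      case 2
      \<comment> \<open>The only generator that does not commute with \<open>A 6\<close> and
        \<open>A 7\<close>; for it the constant is 2.\<close>
      have "A 6 ** X - X ** A 6 = (- 2) *\<^sub>R A 7" "A 7 ** X - X ** A 7 = 2 *\<^sub>R A 6"
        unfolding X 2
        by (simp_all add: square square_left anticommute[of 7 6] anticommute_left[of 7 6]
            matrix_minus_right scaleR_2 flip: matrix_mul_assoc)
      then show ?thesis by blast
    qed
  qed
  then obtain d where d: "A 6 ** X - X ** A 6 = (- d) *\<^sub>R A 7" "A 7 ** X - X ** A 7 = d *\<^sub>R A 6"
    by blast
  have "B ** (a *\<^sub>R X + Y) - (a *\<^sub>R X + Y) ** B = a *\<^sub>R (B ** X - X ** B) + (B ** Y - Y ** B)"
    for B :: "real^8^8"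
    by (simp add: matrix_ring_simps algebra_simps)
  then show ?case
    using c d by (intro exI[of _ "a * d + c"]) (simp add: scaleR_left_distrib scaleR_left_diff_distrib)
qed

lemma g5_subset_lie_algebra: "g5 A \<subseteq> lie_algebra_of (Iso_sub_S7_T5_O8 A)"
proof
  fix X assume X: "X \<in> g5 A"
  then have skX: "X \<in> so_matrices" using g5_subset_so by blast
  obtain c where c: "A 6 ** X - X ** A 6 = (- c) *\<^sub>R A 7" "A 7 ** X - X ** A 7 = c *\<^sub>R A 6"
    using g5_commutators[OF X] by blast
  define E where "E t = matrix_exp (t *\<^sub>R X)" for t
  have "(E t *v (A k *v q)) \<bullet> (A l *v (E t *v q)) = 0"
    if k: "k \<in> {1..5}" and l: "l \<in> {6, 7}" for k l t q
  proof -
    \<comment> \<open>The index \<open>l\<close> is bound afresh: \<open>h 6\<close> and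
      \<open>h 7\<close> form a coupled system, so the claim for one needs the other.\<close>
    define h where "h l t = (E t *v (A k *v q)) \<bullet> (A l *v (E t *v q))" for l t
    have d: "(h l has_real_derivative (E t *v (A k *v q)) \<bullet> ((A l ** X - X ** A l) *v (E t *v q))) (at t)"
      for l t
      unfolding h_def E_def by (rule matrix_exp_inner_derivative_skew[OF skX])
    have d6: "(h 6 has_real_derivative - c * h 7 t) (at t)" for t
      using d[of 6 t] unfolding c
      by (simp add: h_def minus_matrix_vector_mult flip: scaleR_matrix_vector_assoc)
    have d7: "(h 7 has_real_derivative c * h 6 t) (at t)" for t
      using d[of 7 t] unfolding c by (simp add: h_def flip: scaleR_matrix_vector_assoc)
    have "((\<lambda>t. (h 6 t)\<^sup>2 + (h 7 t)\<^sup>2) has_real_derivative 0) (at t)" for t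
      by (rule derivative_eq_intros d6 d7 refl)+ simp
    then have "(h 6 t)\<^sup>2 + (h 7 t)\<^sup>2 = (h 6 0)\<^sup>2 + (h 7 0)\<^sup>2"
      by (intro DERIV_isconst_all) blast
    also have "\<dots> = 0"
      using k by (simp add: h_def E_def matrix_exp_0 inner_A_A)
    finally show ?thesis
      using l by (auto simp: h_def sum_power2_eq_zero_iff)
  qed
  then show "X \<in> lie_algebra_of (Iso_sub_S7_T5_O8 A)"
    using orthogonal_matrix_exp[OF skX]
    by (auto simp: lie_algebra_of_def in_Iso_sub_S7_T5_O8_iff E_def)
qed

section \<open>An orthogonal basis of the space of 8 by 8 matrices\<close>

primrec clifford_word :: "nat list \<Rightarrow> real^8^8" where
  "clifford_word [] = mat 1"
| "clifford_word (i # xs) = A i ** clifford_word xs"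

definition clifford_basis :: "nat set \<Rightarrow> real^8^8" where
  "clifford_basis S = clifford_word (sorted_list_of_set S)"

text \<open>Moving \<open>A j\<close> through the word costs a sign at each letter other than
  \<open>j\<close> and none at \<open>j\<close> itself.\<close>

lemma clifford_word_swap:
  assumes "set xs \<subseteq> {1..7}" "j \<in> {1..7}"
  shows "A j ** clifford_word xs =
    (- 1) ^ length (filter (\<lambda>i. i \<noteq> j) xs) *\<^sub>R (clifford_word xs ** A j)"
  using assms(1)
proof (induction xs)
  case (Cons i xs)
  then have IH: "A j ** clifford_word xs =
      (- 1) ^ length (filter (\<lambda>i. i \<noteq> j) xs) *\<^sub>R (clifford_word xs ** A j)"
    and i: "i \<in> {1..7}" by auto
  show ?case
  proof (cases "i = j")
    case True
    have "A j ** (clifford_word xs ** A j) = (A j ** clifford_word xs) ** A j"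
      by (rule matrix_mul_assoc)
    then show ?thesis
      using True by (simp add: IH matrix_ring_simps)
  next
    case False
    then show ?thesis
      using i assms(2)
      by (simp add: anticommute_left[of j i] IH matrix_scalar_ac
          flip: scalar_matrix_assoc matrix_mul_assoc)
  qed
qed simp

lemma inner_clifford_word_self:
  "set xs \<subseteq> {1..7} \<Longrightarrow> clifford_word xs \<bullet> clifford_word xs = mat 1 \<bullet> (mat 1 :: real^8^8)"
  by (induction xs) (simp_all add: inner_mult_left)

lemma clifford_basis_nonzero:
  assumes "S \<in> small_subsets"
  shows "clifford_basis S \<noteq> 0"
proof -
  have "mat 1 \<noteq> (0 :: real^8^8)"
    by (simp add: mat_def vec_eq_iff)
  moreover have "finite S" "S \<subseteq> {1..7}"
    using assms finite_subset[of S "{1..7}"] by (auto simp: small_subsets_def)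
  ultimately show ?thesis
    using inner_clifford_word_self[of "sorted_list_of_set S"]
    by (auto simp: clifford_basis_def)
qed

text \<open>Left and right multiplication by \<open>A j\<close> are isometries. For a
  \<open>j\<close> that separates the parities they differ by opposite signs on the two products, so
  the inner product equals its own negative.\<close>

lemma clifford_basis_orthogonal:
  assumes S: "S \<in> small_subsets" and T: "T \<in> small_subsets" and "S \<noteq> T"
  shows "clifford_basis S \<bullet> clifford_basis T = 0"
proof -
  have len: "length (filter (\<lambda>i. i \<noteq> j) (sorted_list_of_set U)) = card (U - {j})"
    if "finite U" for U and j :: nat
    using that distinct_card[of "filter (\<lambda>i. i \<noteq> j) (sorted_list_of_set U)"]
    by (simp add: set_diff_eq)
  have swap: "A j ** clifford_basis U = (- 1) ^ card (U - {j}) *\<^sub>R (clifford_basis U ** A j)"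
    if "U \<in> small_subsets" "j \<in> {1..7}" for U j
    using that len[of U j] clifford_word_swap[of "sorted_list_of_set U" j] finite_subset[of U "{1..7}"]
    by (auto simp: small_subsets_def clifford_basis_def)
  obtain j where j: "j \<in> {1..7}" "even (card (S - {j})) \<noteq> even (card (T - {j}))"
    using parity_separates_small_subsets[of S T] S T \<open>S \<noteq> T\<close> by (auto simp: small_subsets_def)
  have "clifford_basis S \<bullet> clifford_basis T = (A j ** clifford_basis S) \<bullet> (A j ** clifford_basis T)"
    using j by (simp add: inner_mult_left)
  also have "\<dots> = - ((clifford_basis S ** A j) \<bullet> (clifford_basis T ** A j))"
    using j by (auto simp: swap S T)
  also have "\<dots> = - (clifford_basis S \<bullet> clifford_basis T)"
    using j by (simp add: inner_mult_right)
  finally show ?thesis by simp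
qed

lemma span_clifford_basis: "span (clifford_basis ` small_subsets) = UNIV"
  using clifford_basis_nonzero clifford_basis_orthogonal finite_small_subsets card_small_subsets
  by (intro spans_if_orthogonal_card) simp_all

text \<open>Transposing gives three signs from the skew factors, and restoring the reversed order
  takes three swaps: six signs in all.\<close>

lemma clifford_basis_triple_symmetric:
  assumes "i \<in> {1..7}" "j \<in> {1..7}" "k \<in> {1..7}" "i \<noteq> j" "j \<noteq> k" "i \<noteq> k"
  shows "transpose (A i ** (A j ** A k)) = A i ** (A j ** A k)"
  using assms
  by (simp add: matrix_transpose_mul transpose_A matrix_minus_left matrix_minus_right
      anticommute[of k i] anticommute[of k j] anticommute_left[of j i] anticommute_left[of k i]
      flip: matrix_mul_assoc)

section \<open>The inclusion of the Lie algebra in \<open>g5 A\<close>\<close>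

text \<open>Differentiating the condition on \<open>exp (t X)\<close> at \<open>t = 0\<close> shows that \<open>A k [A l, X]\<close> is skew, hence
  orthogonal to every symmetric \<open>N\<close>. The choices \<open>N = 1\<close> and \<open>N = A k A l A m\<close> below isolate the
  coefficients of \<open>X\<close> at \<open>A k A l\<close> and \<open>A m\<close>.\<close>

lemma lie_algebra_inner_zero:
  assumes X: "X \<in> lie_algebra_of (Iso_sub_S7_T5_O8 A)"
    and k: "k \<in> {1..5}" and l: "l \<in> {6, 7}" and N: "transpose N = N"
  shows "X \<bullet> (A l ** (A k ** N)) = X \<bullet> (A k ** (N ** A l))"
proof -
  define E where "E t = matrix_exp (t *\<^sub>R X)" for t
  have E: "E t \<in> Iso_sub_S7_T5_O8 A" for t
    using X by (simp add: lie_algebra_of_def E_def)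
  have skX: "X \<in> so_matrices"
    using E by (intro so_matrices_if_orthogonal_exp) (auto simp: in_Iso_sub_S7_T5_O8_iff E_def)
  have kl: "k \<in> {1..7}" "l \<in> {1..7}" "k \<noteq> l" using k l by auto
  let ?M = "A k ** (A l ** X - X ** A l)"
  have unit: "q \<bullet> (?M *v q) = 0" if "q \<in> S7" for q
  proof -
    have "(\<lambda>t. (E t *v (A k *v q)) \<bullet> (A l *v (E t *v q))) = (\<lambda>t. 0)"
      using E k l that by (auto simp: in_Iso_sub_S7_T5_O8_iff)
    moreover have "((\<lambda>t. (E t *v (A k *v q)) \<bullet> (A l *v (E t *v q))) has_real_derivative
        (A k *v q) \<bullet> ((A l ** X - X ** A l) *v q)) (at 0)"
      using matrix_exp_inner_derivative_skew[OF skX, of "A k *v q" "A l" q 0]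
      by (simp add: E_def matrix_exp_0)
    ultimately have "(A k *v q) \<bullet> ((A l ** X - X ** A l) *v q) = 0"
      by (metis DERIV_const DERIV_unique)
    then show ?thesis
      by (simp add: so_matrices_inner[OF skew[OF kl(1)]] matrix_vector_mul_assoc)
  qed
  \<comment> \<open>Homogeneity of the quadratic form extends the vanishing from the unit sphere to
    all vectors.\<close>
  have "q \<bullet> (?M *v q) = 0" for q
  proof (cases "q = 0")
    case False
    define u where "u = q /\<^sub>R norm q"
    have u: "u \<in> S7" "q = norm q *\<^sub>R u"
      using False by (simp_all add: u_def)
    have "q \<bullet> (?M *v q) = norm q * norm q * (u \<bullet> (?M *v u))"
      by (subst (1 2) u(2)) (simp add: matrix_vector_mult_scaleR)
    then show ?thesis using unit[OF u(1)] by simp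
  qed simp
  then have "?M \<bullet> N = 0"
    using N by (intro skew_inner_symmetric) (simp_all add: so_matrices_iff_quadratic)
  moreover have "?M \<bullet> N = X \<bullet> (A l ** (A k ** N)) - X \<bullet> (A k ** (N ** A l))"
    using kl
    by (simp add: matrix_inner_mult_left[of "A k"] matrix_inner_mult_left[of "A l" X]
        matrix_inner_mult_right[of X "A l"] transpose_A inner_diff_left
        matrix_minus_left matrix_minus_right flip: matrix_mul_assoc)
  ultimately show ?thesis by simp
qed

text \<open>With \<open>N\<close> the identity, the two sides are the inner products of
  \<open>X\<close> with \<open>A l ** A k\<close> and with its negative.\<close>

lemma lie_algebra_inner_pair:
  assumes X: "X \<in> lie_algebra_of (Iso_sub_S7_T5_O8 A)" and k: "k \<in> {1..5}" and l: "l \<in> {6, 7}"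
  shows "X \<bullet> (A k ** A l) = 0"
  using lie_algebra_inner_zero[OF X k l, of "mat 1"] k l anticommute[of l k] by auto

lemma lie_algebra_inner_single:
  assumes X: "X \<in> lie_algebra_of (Iso_sub_S7_T5_O8 A)" and m: "m \<in> {1..7}"
  shows "X \<bullet> A m = 0"
proof -
  \<comment> \<open>The indices must avoid \<open>m\<close> to make the triple product symmetric;
    each range offers a second choice.\<close>
  define k :: nat where "k = (if m = 1 then 2 else 1)"
  define l :: nat where "l = (if m = 6 then 7 else 6)"
  have k: "k \<in> {1..5}" and l: "l \<in> {6, 7}" by (auto simp: k_def l_def)
  have kl: "k \<in> {1..7}" "l \<in> {1..7}" "k \<noteq> l" "k \<noteq> m" "l \<noteq> m"
    using k l by (auto simp: k_def l_def)
  have "transpose (A k ** (A l ** A m)) = A k ** (A l ** A m)"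
    using kl m by (intro clifford_basis_triple_symmetric)
  \<comment> \<open>For this triple product the left side reduces to \<open>X \<bullet> A m\<close>
    and the right side to its negative.\<close>
  from lie_algebra_inner_zero[OF X k l this] show ?thesis
    using kl m anticommute[of m l]
    by (simp add: square_left matrix_minus_right flip: matrix_mul_assoc)
qed

lemma lie_algebra_subset_g5: "lie_algebra_of (Iso_sub_S7_T5_O8 A) \<subseteq> g5 A"
proof
  fix X assume X: "X \<in> lie_algebra_of (Iso_sub_S7_T5_O8 A)"
  then have skX: "X \<in> so_matrices"
    by (intro so_matrices_if_orthogonal_exp) (auto simp: lie_algebra_of_def in_Iso_sub_S7_T5_O8_iff)
  \<comment> \<open>The index sets of the generators of \<open>g5 A\<close>; all other basis
    coefficients of \<open>X\<close> have to vanish.\<close>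
  let ?J = "{{i, j} | i j :: nat. (1 \<le> i \<and> i < j \<and> j \<le> 5) \<or> (i = 6 \<and> j = 7)}"
  have "?J \<subseteq> small_subsets"
    by (auto simp: small_subsets_def)
  moreover have "X \<bullet> clifford_basis S = 0" if S: "S \<in> small_subsets - ?J" for S
  proof -
    from S have "S \<in> small_subsets" by simp
    then show ?thesis
    proof (cases rule: small_subsets_cases)
      case 1
      then show ?thesis
        using skew_inner_symmetric[OF skX, of "mat 1"] by (simp add: clifford_basis_def)
    next
      case (2 i)
      then show ?thesis
        using lie_algebra_inner_single[OF X] by (simp add: clifford_basis_def)
    next
      case (3 i j)
      then have "\<not> ((1 \<le> i \<and> i < j \<and> j \<le> 5) \<or> (i = 6 \<and> j = 7))" using S by blast
      \<comment> \<open>An excluded pair with \<open>i < j\<close> must have \<open>j\<close> at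
        least 6, and \<open>i\<close> is then at most 5 because the pair (6,7) is not
        excluded.\<close>
      then have "i \<in> {1..5}" "j \<in> {6, 7}" using 3 by auto
      then show ?thesis
        using lie_algebra_inner_pair[OF X] 3 by (simp add: clifford_basis_def)
    next
      case (4 i j k)
      then show ?thesis
        using skew_inner_symmetric[OF skX, OF clifford_basis_triple_symmetric[of i j k]]
        by (simp add: clifford_basis_def)
    qed
  qed
  ultimately have "X \<in> span (clifford_basis ` ?J)"
    using clifford_basis_orthogonal by (intro in_span_if_orthogonal_rest[OF span_clifford_basis]) auto
  moreover have "clifford_basis ` ?J \<subseteq> {A i ** A j | i j. (1 \<le> i \<and> i < j \<and> j \<le> 5) \<or> (i = 6 \<and> j = 7)}"
  proof (rule image_subsetI)
    fix S assume "S \<in> ?J"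
    then obtain i j where S: "S = {i, j}" and ij: "(1 \<le> i \<and> i < j \<and> j \<le> 5) \<or> (i = 6 \<and> j = 7)"
      by blast
    then have "clifford_basis S = A i ** A j"
      by (auto simp: clifford_basis_def)
    then show "clifford_basis S \<in> {A i ** A j | i j. (1 \<le> i \<and> i < j \<and> j \<le> 5) \<or> (i = 6 \<and> j = 7)}"
      using ij by blast
  qed
  ultimately show "X \<in> g5 A"
    unfolding g5_def using span_mono by blast
qed

end

theorem theorem5p8:
  fixes A :: "nat \<Rightarrow> real^8^8"
  assumes skew: "\<And>i. i \<in> {1..7} \<Longrightarrow> A i \<in> so_matrices"
    and clifford: "\<And>i j. i \<in> {1..7} \<Longrightarrow> j \<in> {1..7} \<Longrightarrow>
      A i ** A j + A j ** A i = (if i = j then -2 else 0) *\<^sub>R mat 1"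
  shows "lie_algebra_of (Iso_sub_S7_T5_O8 A) = g5 A \<and> g5 A \<subseteq> so_matrices"
proof -
  interpret clifford7 A
    using skew clifford by unfold_locales
  show ?thesis
    using lie_algebra_subset_g5 g5_subset_lie_algebra g5_subset_so by blast
qed

end
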